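(* Fix an integer $r\ge0$. For each $n\ge\max(1,r-1)$ let $G^r_n$ be any graph obtained from the linear crossed polyomino chain $G_n$ by deleting $r$ of its vertical edges. Then $$\lim_{n\to\infty}\frac{K\!f(G^r_n)}{W(G^r_n)}=\frac14.$$
   Context: For $n\geq1$, $G_n$ is the simple graph with vertex set $\{1,\ldots,n+1\}\cup\{1',\ldots,(n+1)'\}$ and edge set consisting of the vertical edges $ii'$ for $1\le i\le n+1$ together with, for each $1\le i\le n$, the edges $i(i+1)$, $i'(i+1)'$, $i(i+1)'$, $i'(i+1)$. For $0\le r\le n+1$, $\mathcal{G}^r_n$ is the set of graphs obtained from $G_n$ by deleting exactly $r$ of the vertical edges $ii'$. $W(G)=\sum_{\{u,v\}}d(u,v)$ is the Wiener index (sum of shortest-path distances over unordered pairs of distinct vertices) and $K\!f(G)=\sum_{\{u,v\}}r_{uv}$ is the Kirchhoff index, where $r_{uv}$ is the effective resistance between $u$ and $v$ when every edge is a unit resistor. *)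

theory Defs
  imports
    Complex_Main
    "Graph_Theory.Pair_Digraph"
    "Graph_Theory.Shortest_Path"
begin

text \<open>
  A simple graph is represented by its symmetric loop-free digraph without parallel arcs
  (locale \<^locale>\<open>pair_graph\<close>): the edge \<open>xy\<close> is the pair of arcs \<open>(x, y)\<close>, \<open>(y, x)\<close>.
\<close>

definition simple_graph :: "'a set \<Rightarrow> 'a set set \<Rightarrow> 'a pair_pre_digraph" where
  "simple_graph V E = \<lparr> pverts = V, parcs = {(x, y). {x, y} \<in> E} \<rparr>"

definition graph_distance :: "'a pair_pre_digraph \<Rightarrow> 'a \<Rightarrow> 'a \<Rightarrow> real" where
  "graph_distance G u v = real_of_ereal (wf_digraph.\<mu> (with_proj G) (\<lambda>_. 1) u v)"

text \<open>
  The potential \<open>p\<close> realises a unit current flow from \<open>u\<close> to \<open>v\<close>.  By Ohm's law the current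
  along an arc \<open>(x, y)\<close> of unit resistance is \<open>p x - p y\<close>; the equation is Kirchhoff's current
  law at \<open>x\<close>, with a unit current injected at \<open>u\<close> and extracted at \<open>v\<close>.
\<close>

definition unit_current_potential ::
    "'a pair_pre_digraph \<Rightarrow> 'a \<Rightarrow> 'a \<Rightarrow> ('a \<Rightarrow> real) \<Rightarrow> bool" where
  "unit_current_potential G u v p \<longleftrightarrow>
     (\<forall>x \<in> pverts G. (\<Sum>y \<in> {y. (x, y) \<in> parcs G}. p x - p y) = of_bool (x = u) - of_bool (x = v))"

text \<open>In a finite connected graph such a \<open>p\<close> exists and is unique up to an additive constant.\<close>

definition effective_resistance :: "'a pair_pre_digraph \<Rightarrow> 'a \<Rightarrow> 'a \<Rightarrow> real" where
  "effective_resistance G u v = (THE R. \<exists>p. unit_current_potential G u v p \<and> R = p u - p v)"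

text \<open>
  Distance and resistance are symmetric in \<open>u\<close> and \<open>v\<close>, so a sum over unordered pairs of
  distinct vertices is half the sum over ordered ones.
\<close>

definition wiener_index :: "'a pair_pre_digraph \<Rightarrow> real" where
  "wiener_index G =
     (\<Sum>(u, v) \<in> {(u, v). u \<in> pverts G \<and> v \<in> pverts G \<and> u \<noteq> v}. graph_distance G u v) / 2"

definition kirchhoff_index :: "'a pair_pre_digraph \<Rightarrow> real" where
  "kirchhoff_index G =
     (\<Sum>(u, v) \<in> {(u, v). u \<in> pverts G \<and> v \<in> pverts G \<and> u \<noteq> v}. effective_resistance G u v) / 2"

text \<open>The vertices \<open>i\<close> and \<open>i'\<close> are \<open>Unprimed i\<close> and \<open>Primed i\<close>.\<close>

datatype vertex = Unprimed nat | Primed nat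

definition crossed_chain_verts :: "nat \<Rightarrow> vertex set" where
  "crossed_chain_verts n = Unprimed ` {1..n+1} \<union> Primed ` {1..n+1}"

definition vertical_edges :: "nat \<Rightarrow> vertex set set" where
  "vertical_edges n = {{Unprimed i, Primed i} | i. 1 \<le> i \<and> i \<le> n + 1}"

definition crossed_chain_edges :: "nat \<Rightarrow> vertex set set" where
  "crossed_chain_edges n = vertical_edges n
     \<union> {{Unprimed i, Unprimed (i+1)} | i. 1 \<le> i \<and> i \<le> n}
     \<union> {{Primed i, Primed (i+1)} | i. 1 \<le> i \<and> i \<le> n}
     \<union> {{Unprimed i, Primed (i+1)} | i. 1 \<le> i \<and> i \<le> n}
     \<union> {{Primed i, Unprimed (i+1)} | i. 1 \<le> i \<and> i \<le> n}"

text \<open>The set \<open>\<G>\<^sup>r\<^sub>n\<close>; for \<open>r = 0\<close> its only element is the linear crossed polyomino chain \<open>G\<^sub>n\<close>.\<close>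

definition crossed_chains_deleting :: "nat \<Rightarrow> nat \<Rightarrow> vertex pair_pre_digraph set" where
  "crossed_chains_deleting r n =
     {simple_graph (crossed_chain_verts n) (crossed_chain_edges n - F) | F.
        F \<subseteq> vertical_edges n \<and> card F = r}"

lemma crossed_chains_deleting_pair_graph:
  assumes "G \<in> crossed_chains_deleting r n"
  shows "pair_graph G"
proof -
  obtain F where G: "G = simple_graph (crossed_chain_verts n) (crossed_chain_edges n - F)"
    using assms by (auto simp: crossed_chains_deleting_def)
  have V: "x \<in> crossed_chain_verts n" "y \<in> crossed_chain_verts n" "x \<noteq> y"
    if "{x, y} \<in> crossed_chain_edges n" for x y
    using that
    by (auto simp: crossed_chain_edges_def vertical_edges_def crossed_chain_verts_def doubleton_eq_iff)
  have fin: "finite (crossed_chain_verts n)"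
    by (simp add: crossed_chain_verts_def)
  have sub: "parcs G \<subseteq> crossed_chain_verts n \<times> crossed_chain_verts n"
    using V by (auto simp: G simple_graph_def)
  show ?thesis
  proof
    show "finite (pverts G)"
      using fin by (simp add: G simple_graph_def)
    show "finite (parcs G)"
      using fin sub finite_subset by blast
    show "symmetric (with_proj G)"
      by (auto simp: symmetric_def sym_def G simple_graph_def insert_commute)
  qed (use V sub in \<open>auto simp: G simple_graph_def\<close>)
qed

end

theory Submission
  imports Defs
begin

text \<open>
  Write \<open>k\<close> for the level of the vertices \<open>k\<close> and \<open>k'\<close>. Consecutive levels are joined completely, so
  both a shortest path and a current flow see the chain essentially as a path of levels: a distance
  is the difference of levels up to \<open>2\<close>, while between consecutive levels the four parallel unit
  resistors act as a resistance \<open>1/4\<close>, so that \<open>4 r\<^sub>u\<^sub>v\<close> is the difference of levels up to a constant.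
  The errors sum to \<open>O(n\<^sup>2)\<close>, whereas the Wiener index grows like \<open>n\<^sup>3\<close>. The deleted
  vertical edges only enter the bounded errors.
\<close>

section \<open>Distances from walks and Lipschitz functions\<close>

lemma (in wf_digraph) awalk_cost_ge_potential_diff:
  fixes h :: "'a \<Rightarrow> real"
  assumes "awalk u p v" and "\<And>e. e \<in> arcs G \<Longrightarrow> \<bar>h (tail G e) - h (head G e)\<bar> \<le> c e"
  shows "\<bar>h u - h v\<bar> \<le> awalk_cost c p"
  using assms(1)
proof (induction p arbitrary: u)
  case Nil
  then show ?case by (simp add: awalk_Nil_iff)
next
  case (Cons e p)
  then have "\<bar>h (head G e) - h v\<bar> \<le> awalk_cost c p" "\<bar>h u - h (head G e)\<bar> \<le> c e"
    using assms(2) by (auto simp: awalk_Cons_iff)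
  then show ?case by simp
qed

lemma (in pair_wf_digraph) graph_distance_between:
  fixes h :: "'a \<Rightarrow> real"
  assumes "awalk u p v" and "\<And>x y. (x, y) \<in> parcs G \<Longrightarrow> \<bar>h x - h y\<bar> \<le> 1"
  shows "\<bar>h u - h v\<bar> \<le> graph_distance G u v" "graph_distance G u v \<le> length p"
proof -
  have "awalk_cost (\<lambda>_. 1) p = length p"
    by (simp add: awalk_cost_def sum_list_triv)
  then have upper: "\<mu> (\<lambda>_. 1) u v \<le> ereal (length p)"
    using min_cost_le_walk_cost[OF assms(1), of "\<lambda>_. 1"] by simp
  have lower: "ereal \<bar>h u - h v\<bar> \<le> \<mu> (\<lambda>_. 1) u v"
    unfolding \<mu>_def
  proof (rule INF_greatest)
    fix q assume "q \<in> {q. awalk u q v}"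
    then have "awalk u q v" by simp
    then show "ereal \<bar>h u - h v\<bar> \<le> ereal (awalk_cost (\<lambda>_. 1) q)"
      using awalk_cost_ge_potential_diff[of u q v h "\<lambda>_. 1"] assms(2) by auto
  qed
  \<comment> \<open>The two bounds make the infimum finite, so \<open>real_of_ereal\<close> returns
    its true value and not a default.\<close>
  obtain d where "\<mu> (\<lambda>_. 1) u v = ereal d"
    using upper lower by (cases "\<mu> (\<lambda>_. 1) u v") auto
  then show "\<bar>h u - h v\<bar> \<le> graph_distance G u v" "graph_distance G u v \<le> length p"
    using upper lower by (auto simp: graph_distance_def)
qed

section \<open>The Laplacian and effective resistance\<close>

definition laplacian :: "'a pair_pre_digraph \<Rightarrow> ('a \<Rightarrow> real) \<Rightarrow> 'a \<Rightarrow> real" where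
  "laplacian G p x = (\<Sum>y \<in> {y. (x, y) \<in> parcs G}. p x - p y)"

lemma unit_current_potential_iff_laplacian:
  "unit_current_potential G u v p \<longleftrightarrow>
     (\<forall>x \<in> pverts G. laplacian G p x = of_bool (x = u) - of_bool (x = v))"
  by (simp add: unit_current_potential_def laplacian_def)

text \<open>Both sides become sums over arcs. The diagonal terms \<open>q x * p x\<close> agree, and
  the mixed terms are exchanged by reversing every arc.\<close>

lemma (in pair_graph) laplacian_self_adjoint:
  "(\<Sum>x \<in> pverts G. q x * laplacian G p x) = (\<Sum>x \<in> pverts G. p x * laplacian G q x)"
proof -
  have arcs: "(\<Sum>x \<in> pverts G. \<Sum>y \<in> {y. (x, y) \<in> parcs G}. f x y) = (\<Sum>(x, y) \<in> parcs G. f x y)"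
    for f :: "'a \<Rightarrow> 'a \<Rightarrow> real"
  proof -
    have "finite {y. (x, y) \<in> parcs G}" for x
      by (rule finite_subset[OF _ pair_finite_verts]) (auto dest: in_arcsD2)
    moreover have "Sigma (pverts G) (\<lambda>x. {y. (x, y) \<in> parcs G}) = parcs G"
      by (auto dest: in_arcsD1)
    ultimately show ?thesis
      using sum.Sigma[OF pair_finite_verts, of "\<lambda>x. {y. (x, y) \<in> parcs G}" f] by simp
  qed
  have swap: "(\<Sum>(x, y) \<in> parcs G. f x y) = (\<Sum>(x, y) \<in> parcs G. f y x)"
    for f :: "'a \<Rightarrow> 'a \<Rightarrow> real"
    by (rule sum.reindex_bij_witness[of _ prod.swap prod.swap]) (auto dest: arcs_symmetric)
  have expand: "(\<Sum>x \<in> pverts G. q x * laplacian G p x)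
      = (\<Sum>(x, y) \<in> parcs G. q x * p x) - (\<Sum>(x, y) \<in> parcs G. q x * p y)" for p q :: "'a \<Rightarrow> real"
    unfolding laplacian_def sum_distrib_left arcs
    by (simp add: right_diff_distrib sum_subtractf case_prod_unfold)
  show ?thesis
    unfolding expand using swap[of "\<lambda>x y. q x * p y"] by (simp add: mult.commute)
qed

text \<open>
  Testing each of two potentials for the same flow against the Laplacian of the other shows that they
  agree on the voltage drop.
\<close>
lemma (in pair_graph) effective_resistance_eq:
  assumes "u \<in> pverts G" "v \<in> pverts G" "unit_current_potential G u v p"
  shows "effective_resistance G u v = p u - p v"
proof -
  have drop: "(\<Sum>x \<in> pverts G. q x * laplacian G p x) = q u - q v"
    if "unit_current_potential G u v p" for p q
  proof -
    have "(\<Sum>x \<in> pverts G. q x * laplacian G p x)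
        = (\<Sum>x \<in> pverts G. q x * of_bool (x = u) - q x * of_bool (x = v))"
      using that by (intro sum.cong) (auto simp: unit_current_potential_iff_laplacian)
    also have "\<dots> = q u - q v"
    proof -
      have "(\<Sum>x \<in> pverts G. q x * of_bool (x = w)) = q w" if "w \<in> pverts G" for w
        using that sum.delta'[OF pair_finite_verts, of w q]
        by (simp add: of_bool_def if_distrib eq_commute cong: if_cong)
      then show ?thesis using assms(1,2) by (simp add: sum_subtractf)
    qed
    finally show ?thesis .
  qed
  show ?thesis
    unfolding effective_resistance_def
  proof (rule the_equality)
    show "\<exists>q. unit_current_potential G u v q \<and> p u - p v = q u - q v"
      using assms(3) by blast
  next
    fix R assume "\<exists>q. unit_current_potential G u v q \<and> R = q u - q v"
    then obtain q where q: "unit_current_potential G u v q" "R = q u - q v" by blast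
    then show "R = p u - p v"
      using drop[OF assms(3), of q] drop[OF q(1), of p] laplacian_self_adjoint[of q p] by simp
  qed
qed

section \<open>Levels, mates and layers of the chain\<close>

fun level :: "vertex \<Rightarrow> int" where
  "level (Unprimed i) = int i"
| "level (Primed i) = int i"

fun mate :: "vertex \<Rightarrow> vertex" where
  "mate (Unprimed i) = Primed i"
| "mate (Primed i) = Unprimed i"

lemma level_mate [simp]: "level (mate x) = level x"
  by (cases x) auto

lemma mate_neq [simp]: "mate x \<noteq> x" "x \<noteq> mate x"
  by (cases x; simp)+

lemma same_level_iff: "level x = level y \<longleftrightarrow> x = y \<or> x = mate y"
  by (cases x; cases y) auto

lemma mem_crossed_chain_verts_iff:
  "x \<in> crossed_chain_verts n \<longleftrightarrow> 1 \<le> level x \<and> level x \<le> int n + 1"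
  by (cases x) (auto simp: crossed_chain_verts_def)

lemma finite_crossed_chain_verts [simp]: "finite (crossed_chain_verts n)"
  by (simp add: crossed_chain_verts_def)

lemma sum_crossed_chain_verts:
  "(\<Sum>x \<in> crossed_chain_verts n. f x) = (\<Sum>i = 1..n+1. f (Unprimed i) + f (Primed i))"
  unfolding crossed_chain_verts_def
  by (subst sum.union_disjoint) (auto simp: sum.reindex inj_on_def sum.distrib)

lemma crossed_chain_edge_iff:
  "{x, y} \<in> crossed_chain_edges n \<longleftrightarrow>
     x \<in> crossed_chain_verts n \<and> y \<in> crossed_chain_verts n \<and>
     (\<bar>level x - level y\<bar> = 1 \<or> y = mate x)"
proof -
  have step: "\<exists>i. (a = i \<and> b = Suc i \<or> a = Suc i \<and> b = i) \<and> Suc 0 \<le> i \<and> i \<le> n"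
    if "Suc 0 \<le> a" "int a \<le> int n + 1" "Suc 0 \<le> b" "int b \<le> int n + 1" "\<bar>int a - int b\<bar> = 1"
    for a b
    using that by (intro exI[of _ "min a b"]) linarith
  show ?thesis
    by (cases x; cases y)
      (auto simp: crossed_chain_edges_def vertical_edges_def doubleton_eq_iff
        mem_crossed_chain_verts_iff intro: step)
qed

lemma vertical_edge_levels: "{x, y} \<in> vertical_edges n \<Longrightarrow> level x = level y"
  by (auto simp: vertical_edges_def doubleton_eq_iff)

text \<open>Integer levels and the value 0 outside the range let the end levels obey the same
  Laplacian formula as the inner ones.\<close>

definition layer_sum :: "nat \<Rightarrow> (vertex \<Rightarrow> real) \<Rightarrow> int \<Rightarrow> real" where
  "layer_sum n f k =
     (if 1 \<le> k \<and> k \<le> int n + 1 then f (Unprimed (nat k)) + f (Primed (nat k)) else 0)"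

lemma layer_sum_eq: "layer_sum n f k = (\<Sum>y \<in> {y \<in> crossed_chain_verts n. level y = k}. f y)"
proof (cases "1 \<le> k \<and> k \<le> int n + 1")
  case True
  have "y \<in> crossed_chain_verts n \<and> level y = k \<longleftrightarrow> y = Unprimed (nat k) \<or> y = Primed (nat k)" for y
    using True by (cases y) (auto simp: mem_crossed_chain_verts_iff)
  then have "{y \<in> crossed_chain_verts n. level y = k} = {Unprimed (nat k), Primed (nat k)}" by auto
  then show ?thesis using True by (simp add: layer_sum_def)
next
  case False
  then have "{y \<in> crossed_chain_verts n. level y = k} = {}"
    by (auto simp: mem_crossed_chain_verts_iff)
  with False show ?thesis by (simp only: layer_sum_def) simp
qed

lemma layer_sum_diff:
  "layer_sum n (\<lambda>y. c - f y) k
   = of_bool (1 \<le> k \<and> k \<le> int n + 1) * 2 * c - layer_sum n f k"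
  by (simp add: layer_sum_def)

section \<open>Distances in a chain with deleted vertical edges\<close>

locale crossed_chain =
  fixes n :: nat and F :: "vertex set set"
  assumes n_pos: "1 \<le> n" and F_vertical: "F \<subseteq> vertical_edges n"
begin

definition G where "G = simple_graph (crossed_chain_verts n) (crossed_chain_edges n - F)"

lemma pverts_G [simp]: "pverts G = crossed_chain_verts n"
  by (simp add: G_def simple_graph_def)

text \<open>Edges in \<open>F\<close> join mates, so every edge between consecutive levels
  survives.\<close>

lemma arc_iff:
  "(x, y) \<in> parcs G \<longleftrightarrow>
     x \<in> crossed_chain_verts n \<and> y \<in> crossed_chain_verts n \<and>
     (\<bar>level x - level y\<bar> = 1 \<or> y = mate x \<and> {x, mate x} \<notin> F)"
  using F_vertical vertical_edge_levels[of x y n]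
  by (auto simp: G_def simple_graph_def crossed_chain_edge_iff)

sublocale pair_graph G
  by (rule crossed_chains_deleting_pair_graph[of _ "card F" n])
    (use F_vertical in \<open>auto simp: crossed_chains_deleting_def G_def\<close>)

text \<open>Move one level towards \<open>v\<close> at each step. The induction starts at level
  difference 1, since mates need not be adjacent.\<close>

lemma exists_awalk:
  assumes "u \<in> crossed_chain_verts n" "v \<in> crossed_chain_verts n"
    and "\<bar>level u - level v\<bar> = int (Suc m)"
  shows "\<exists>p. awalk u p v \<and> length p = Suc m"
  using assms
proof (induction m arbitrary: u)
  case 0
  then have "awalk u [(u, v)] v"
    by (simp add: awalk_Cons_iff awalk_Nil_iff arc_iff)
  then show ?case by force
next
  case (Suc m)
  define w where "w = Unprimed (nat (if level u < level v then level u + 1 else level u - 1))"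
  have w: "level w = (if level u < level v then level u + 1 else level u - 1)"
    using Suc.prems by (auto simp: w_def mem_crossed_chain_verts_iff)
  have "w \<in> crossed_chain_verts n" "\<bar>level w - level v\<bar> = int (Suc m)" "\<bar>level u - level w\<bar> = 1"
    using Suc.prems w by (auto simp: mem_crossed_chain_verts_iff split: if_splits)
  moreover from this obtain p where "awalk w p v" "length p = Suc m"
    using Suc.IH Suc.prems(2) by blast
  ultimately have "awalk u ((u, w) # p) v" "length ((u, w) # p) = Suc (Suc m)"
    using Suc.prems by (auto simp: awalk_Cons_iff arc_iff)
  then show ?case by blast
qed

lemma exists_short_awalk:
  assumes u: "u \<in> crossed_chain_verts n" and v: "v \<in> crossed_chain_verts n"
  shows "\<exists>p. awalk u p v \<and> length p \<le> \<bar>level u - level v\<bar> + 2"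
proof (cases "level u = level v")
  case False
  then obtain m where "\<bar>level u - level v\<bar> = int (Suc m)"
    by (metis abs_ge_zero abs_eq_0 eq_iff_diff_eq_0 nonneg_int_cases not0_implies_Suc of_nat_0)
  then show ?thesis using exists_awalk[OF u v] by fastforce
next
  case True
  \<comment> \<open>A detour through a neighbouring level and back, which costs the extra 2. From
    level 1 it goes up, and level 2 exists because \<open>n\<close> is positive.\<close>
  define w where "w = Unprimed (if level u = 1 then 2 else nat (level u - 1))"
  have w: "w \<in> crossed_chain_verts n" "\<bar>level u - level w\<bar> = 1" "\<bar>level w - level v\<bar> = 1"
    using u True n_pos by (auto simp: w_def mem_crossed_chain_verts_iff)
  then have "awalk u [(u, w), (w, v)] v"
    using u v by (simp add: awalk_Cons_iff awalk_Nil_iff arc_iff)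
  then show ?thesis using True by force
qed

lemma graph_distance_bounds:
  assumes "u \<in> crossed_chain_verts n" "v \<in> crossed_chain_verts n"
  shows "\<bar>level u - level v\<bar> \<le> graph_distance G u v"
    "graph_distance G u v \<le> real_of_int \<bar>level u - level v\<bar> + 2"
proof -
  obtain p where p: "awalk u p v" "length p \<le> \<bar>level u - level v\<bar> + 2"
    using exists_short_awalk assms by blast
  have "\<bar>real_of_int (level x) - real_of_int (level y)\<bar> \<le> 1" if "(x, y) \<in> parcs G" for x y
    using that by (auto simp: arc_iff)
  note between = graph_distance_between[OF p(1), of "\<lambda>x. real_of_int (level x)", OF this]
  show "\<bar>level u - level v\<bar> \<le> graph_distance G u v" using between(1) by simp
  have "real (length p) \<le> \<bar>level u - level v\<bar> + 2" using p(2) by linarith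
  with between(2) show "graph_distance G u v \<le> real_of_int \<bar>level u - level v\<bar> + 2" by simp
qed

section \<open>Green functions and resistances of the chain\<close>

lemma laplacian_eq:
  assumes x: "x \<in> crossed_chain_verts n"
  shows "laplacian G p x = of_bool ({x, mate x} \<notin> F) * (p x - p (mate x))
    + layer_sum n (\<lambda>y. p x - p y) (level x - 1) + layer_sum n (\<lambda>y. p x - p y) (level x + 1)"
proof -
  let ?A = "if {x, mate x} \<notin> F then {mate x} else {}"
  let ?L = "\<lambda>k. {y \<in> crossed_chain_verts n. level y = k}"
  have "{y. (x, y) \<in> parcs G} = ?A \<union> (?L (level x - 1) \<union> ?L (level x + 1))"
    using x by (auto simp: arc_iff mem_crossed_chain_verts_iff)
  moreover have "?A \<inter> (?L (level x - 1) \<union> ?L (level x + 1)) = {}"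
    "?L (level x - 1) \<inter> ?L (level x + 1) = {}" by auto
  ultimately show ?thesis
    by (simp add: laplacian_def sum.union_disjoint layer_sum_eq)
qed

text \<open>
  A unit injection at \<open>u\<close> is the sum of \<open>1/2\<close> at both \<open>u\<close> and its mate, which flows along the
  levels, and of \<open>1/2\<close> at \<open>u\<close> and \<open>- 1/2\<close> at its mate, whose potential is supported on the level of
  \<open>u\<close>, since the currents it sends into a neighbouring level cancel there. With the first part
  extracted at the two end levels, the sink does not depend on \<open>u\<close> and cancels in differences.
\<close>

definition weight :: "vertex \<Rightarrow> real" where
  "weight u = 2 * of_bool ({u, mate u} \<notin> F) + 2 * of_bool (1 < level u)
    + 2 * of_bool (level u < int n + 1)"

definition local_potential :: "vertex \<Rightarrow> vertex \<Rightarrow> real" where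
  "local_potential u x =
     (if x = u then 1 / (2 * weight u) else if x = mate u then - 1 / (2 * weight u) else 0)"

text \<open>Of the total current 1 injected at the level of \<open>u\<close>, 1/2 crosses each gap
  between consecutive levels. Through the resistance 1/4 of a gap it drops the potential by
  1/8.\<close>

definition level_potential :: "vertex \<Rightarrow> vertex \<Rightarrow> real" where
  "level_potential u x = - \<bar>level x - level u\<bar> / 8"

definition green :: "vertex \<Rightarrow> vertex \<Rightarrow> real" where
  "green u x = local_potential u x + level_potential u x"

text \<open>A neighbouring level always exists and alone contributes 2. This bounds local potentials
  by 1/4.\<close>

lemma weight_ge: "u \<in> crossed_chain_verts n \<Longrightarrow> 2 \<le> weight u"
  using n_pos by (auto simp: weight_def mem_crossed_chain_verts_iff)

text \<open>Antisymmetry under \<open>mate\<close> makes all layer sums vanish, so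
  \<open>local_potential u\<close> is an eigenfunction of the Laplacian with eigenvalue
  \<open>weight u\<close>. Its values are scaled so that the injected currents are 1/2 and
  -1/2.\<close>

lemma laplacian_local_potential:
  assumes u: "u \<in> crossed_chain_verts n" and x: "x \<in> crossed_chain_verts n"
  shows "laplacian G (local_potential u) x = (of_bool (x = u) - of_bool (x = mate u)) / 2"
proof -
  have "layer_sum n (local_potential u) k = 0" for k
    by (cases u) (auto simp: layer_sum_def local_potential_def)
  then have "laplacian G (local_potential u) x =
      of_bool ({x, mate x} \<notin> F) * (local_potential u x - local_potential u (mate x))
      + (2 * of_bool (1 < level x) + 2 * of_bool (level x < int n + 1)) * local_potential u x"
    using x by (simp add: laplacian_eq layer_sum_diff mem_crossed_chain_verts_iff)
  also have "local_potential u (mate x) = - local_potential u x"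
    by (cases u; cases x) (auto simp: local_potential_def)
  finally have lap: "laplacian G (local_potential u) x = weight x * local_potential u x"
    by (simp add: weight_def algebra_simps)
  have "weight (mate u) = weight u"
    by (cases u) (simp_all add: weight_def insert_commute)
  with lap weight_ge[OF u] show ?thesis
    by (auto simp: local_potential_def)
qed

text \<open>The second difference of the absolute value is concentrated at the level of
  \<open>u\<close>. At an end level two neighbours are missing, each with a drop of 1/8, hence the
  sink 1/4 per end vertex.\<close>

lemma laplacian_level_potential:
  assumes u: "u \<in> crossed_chain_verts n" and x: "x \<in> crossed_chain_verts n"
  shows "laplacian G (level_potential u) x = of_bool (level x = level u) / 2
    - (of_bool (level x = 1) + of_bool (level x = int n + 1)) / 4"
  unfolding laplacian_eq[OF x]
  using u x n_pos
  by (auto simp: layer_sum_def level_potential_def mem_crossed_chain_verts_iff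
      abs_if field_simps split: if_splits)

lemma laplacian_green:
  assumes u: "u \<in> crossed_chain_verts n" and x: "x \<in> crossed_chain_verts n"
  shows "laplacian G (green u) x = of_bool (x = u)
    - (of_bool (level x = 1) + of_bool (level x = int n + 1)) / 4"
proof -
  have "laplacian G (green u) x
      = laplacian G (local_potential u) x + laplacian G (level_potential u) x"
    unfolding laplacian_def green_def sum.distrib[symmetric] by (intro sum.cong) auto
  then show ?thesis
    using assms
    by (auto simp: laplacian_local_potential laplacian_level_potential same_level_iff)
qed

lemma unit_current_potential_green:
  assumes "u \<in> crossed_chain_verts n" "v \<in> crossed_chain_verts n"
  shows "unit_current_potential G u v (\<lambda>x. green u x - green v x)"
proof -
  have "laplacian G (\<lambda>x. green u x - green v x) x
      = laplacian G (green u) x - laplacian G (green v) x"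
    for x
    unfolding laplacian_def sum_subtractf[symmetric] by (intro sum.cong) auto
  then show ?thesis
    using assms by (simp add: unit_current_potential_iff_laplacian laplacian_green)
qed

text \<open>The level potentials contribute exactly a quarter of the level difference. The error
  consists of four local potentials, each at most 1/4 in absolute value.\<close>

lemma effective_resistance_bounds:
  assumes u: "u \<in> crossed_chain_verts n" and v: "v \<in> crossed_chain_verts n"
  shows "\<bar>effective_resistance G u v - \<bar>level u - level v\<bar> / 4\<bar> \<le> 1"
proof -
  have bound: "\<bar>local_potential w x\<bar> \<le> 1 / 4" if "w \<in> crossed_chain_verts n" for w x
    using weight_ge[OF that] by (auto simp: local_potential_def field_simps)
  have "effective_resistance G u v = green u u - green v u - (green u v - green v v)"
    using effective_resistance_eq[OF _ _ unit_current_potential_green[OF u v]] u v by simp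
  also have "\<dots> = (local_potential u u - local_potential v u - local_potential u v
      + local_potential v v) + \<bar>level u - level v\<bar> / 4"
    by (simp add: green_def level_potential_def abs_minus_commute)
  finally show ?thesis
    using bound[OF u, of u] bound[OF v, of u] bound[OF u, of v] bound[OF v, of v] by linarith
qed

section \<open>Comparison of the two indices\<close>

lemma kirchhoff_wiener_diff:
  "\<bar>kirchhoff_index G - wiener_index G / 4\<bar> \<le> 3 * (real n + 1)\<^sup>2"
proof -
  let ?V = "crossed_chain_verts n"
  let ?P = "{(u, v). u \<in> pverts G \<and> v \<in> pverts G \<and> u \<noteq> v}"
  let ?f = "\<lambda>(u, v). effective_resistance G u v - graph_distance G u v / 4"
  \<comment> \<open>The resistance contributes an error of at most 1, a quarter of the distance at
    most 2/4.\<close>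
  have "\<bar>?f e\<bar> \<le> 3 / 2" if e: "e \<in> ?P" for e
  proof (cases e)
    case (Pair u v)
    with e have uv: "u \<in> ?V" "v \<in> ?V" by auto
    define L where "L = real_of_int \<bar>level u - level v\<bar>"
    show ?thesis
      using effective_resistance_bounds[OF uv] graph_distance_bounds[OF uv]
      unfolding Pair prod.case L_def[symmetric] by linarith
  qed
  then have "(\<Sum>e \<in> ?P. \<bar>?f e\<bar>) \<le> real (card ?P) * (3 / 2)"
    by (rule sum_bounded_above)
  then have "\<bar>\<Sum>e \<in> ?P. ?f e\<bar> \<le> real (card ?P) * (3 / 2)"
    using sum_abs[of ?f ?P] by linarith
  moreover have "card ?P \<le> (2 * (n + 1))\<^sup>2"
  proof -
    have "card ?V = 2 * (n + 1)"
      using sum_crossed_chain_verts[where f = "\<lambda>_. 1 :: nat" and n = n] by simp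
    moreover have "card ?P \<le> card (?V \<times> ?V)"
      by (rule card_mono) auto
    ultimately show ?thesis by (simp add: card_cartesian_product power2_eq_square)
  qed
  then have "real (card ?P) \<le> (2 * (real n + 1))\<^sup>2"
    by (metis (mono_tags, lifting) of_nat_1 of_nat_add of_nat_le_iff of_nat_mult of_nat_numeral
        of_nat_power)
  moreover have "(\<Sum>e \<in> ?P. ?f e) = 2 * (kirchhoff_index G - wiener_index G / 4)"
    by (simp add: kirchhoff_index_def wiener_index_def case_prod_unfold sum_subtractf
        flip: sum_divide_distrib)
  ultimately have "\<bar>2 * (kirchhoff_index G - wiener_index G / 4)\<bar> \<le> (2 * (real n + 1))\<^sup>2 * (3 / 2)"
    by linarith
  then show ?thesis unfolding abs_mult power_mult_distrib by simp
qed

end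

section \<open>Cubic growth of the Wiener index and the limit\<close>

lemma sum_abs_diff_nat:
  "(\<Sum>i = 1..N. \<Sum>j = 1..N. \<bar>real i - real j\<bar>) = real N * ((real N)\<^sup>2 - 1) / 3"
proof (induction N)
  case (Suc N)
  have "(\<Sum>i = 1..N. \<bar>real i - real (Suc N)\<bar>) = real N * (real N + 1) / 2"
  proof -
    have "(\<Sum>i = 1..N. \<bar>real i - real (Suc N)\<bar>) = (\<Sum>i = 1..N. real N + 1 - real i)"
      by (intro sum.cong) auto
    also have "\<dots> = real N * (real N + 1) / 2"
      using double_gauss_sum_from_Suc_0[of N, where 'a = real] by (simp add: sum_subtractf field_simps)
    finally show ?thesis .
  qed
  moreover from this have "(\<Sum>i = 1..N. \<bar>real (Suc N) - real i\<bar>) = real N * (real N + 1) / 2"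
    by (simp only: abs_minus_commute)
  moreover have split: "(\<Sum>i = 1..Suc N. \<Sum>j = 1..Suc N. f i j) = (\<Sum>i = 1..N. \<Sum>j = 1..N. f i j)
      + (\<Sum>i = 1..N. f i (Suc N)) + (\<Sum>j = 1..N. f (Suc N) j) + f (Suc N) (Suc N)"
    for f :: "nat \<Rightarrow> nat \<Rightarrow> real"
    by (simp add: sum.distrib)
  ultimately show ?case
    unfolding split Suc.IH by (simp only: of_nat_Suc) (simp add: power2_eq_square field_simps)
qed simp

text \<open>Each ordered pair of levels carries four ordered pairs of vertices; halving for
  unordered pairs leaves the factor 2 before the sum of level differences.\<close>

lemma (in crossed_chain) wiener_index_ge:
  "2 / 3 * (real n + 1) * ((real n + 1)\<^sup>2 - 1) \<le> wiener_index G"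
proof -
  let ?V = "crossed_chain_verts n"
  let ?P = "{(u, v). u \<in> pverts G \<and> v \<in> pverts G \<and> u \<noteq> v}"
  let ?d = "\<lambda>u v. real_of_int \<bar>level u - level v\<bar>"
  have "4 * (\<Sum>i = 1..n+1. \<Sum>j = 1..n+1. \<bar>real i - real j\<bar>) = (\<Sum>u \<in> ?V. \<Sum>v \<in> ?V. ?d u v)"
    unfolding sum_crossed_chain_verts sum_distrib_left sum.distrib[symmetric]
    by (intro sum.cong refl) simp
  also have "\<dots> = (\<Sum>(u, v) \<in> ?V \<times> ?V. ?d u v)"
    by (simp add: sum.cartesian_product)
  also have "\<dots> = (\<Sum>(u, v) \<in> ?P. ?d u v)"
    by (rule sum.mono_neutral_right) auto
  also have "\<dots> \<le> (\<Sum>(u, v) \<in> ?P. graph_distance G u v)"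
    using graph_distance_bounds(1) by (intro sum_mono) auto
  finally show ?thesis
    using sum_abs_diff_nat[of "n + 1"] by (simp add: wiener_index_def field_simps)
qed

lemma (in crossed_chain) kirchhoff_wiener_ratio:
  "\<bar>kirchhoff_index G / wiener_index G - 1 / 4\<bar> \<le> 9 / (2 * real n)"
proof -
  let ?N = "real n + 1"
  have fact: "?N\<^sup>2 - 1 = real n * (real n + 2)" by (simp add: power2_eq_square algebra_simps)
  \<comment> \<open>Weakening \<open>n + 2\<close> to \<open>n + 1\<close> makes the square of
    \<open>n + 1\<close> cancel against the error bound.\<close>
  have "2 / 3 * ?N * (real n * ?N) \<le> 2 / 3 * ?N * (?N\<^sup>2 - 1)"
    unfolding fact by (intro mult_left_mono) auto
  moreover have "2 / 3 * ?N * (real n * ?N) = 2 / 3 * real n * ?N\<^sup>2"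
    by (simp add: power2_eq_square)
  ultimately have W: "2 / 3 * real n * ?N\<^sup>2 \<le> wiener_index G"
    using wiener_index_ge by linarith
  moreover have pos: "0 < 2 / 3 * real n * ?N\<^sup>2"
    using n_pos by simp
  ultimately have Wpos: "0 < wiener_index G" by linarith
  then have "\<bar>kirchhoff_index G / wiener_index G - 1 / 4\<bar>
      = \<bar>kirchhoff_index G - wiener_index G / 4\<bar> / wiener_index G"
    by (simp add: field_simps abs_divide)
  also have "\<dots> \<le> 3 * ?N\<^sup>2 / (2 / 3 * real n * ?N\<^sup>2)"
    by (rule frac_le[OF _ kirchhoff_wiener_diff pos W]) simp
  also have "\<dots> = 9 / (2 * real n)"
    by (simp add: field_simps)
  finally show ?thesis .
qed

theorem theorem4p3:
  fixes r :: nat and G :: "nat \<Rightarrow> vertex pair_pre_digraph"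
  assumes "\<And>n. n \<ge> max 1 (r - 1) \<Longrightarrow> G n \<in> crossed_chains_deleting r n"
  shows "(\<lambda>n. kirchhoff_index (G n) / wiener_index (G n)) \<longlonglongrightarrow> 1 / 4"
proof -
  \<comment> \<open>The bound depends on \<open>n\<close> alone, so the deleted edges may be chosen
    anew for each \<open>n\<close>.\<close>
  have "\<bar>kirchhoff_index (G n) / wiener_index (G n) - 1 / 4\<bar> \<le> 9 / (2 * real n)"
    if n: "n \<ge> max 1 (r - 1)" for n
  proof -
    obtain F where "F \<subseteq> vertical_edges n"
      and G: "G n = simple_graph (crossed_chain_verts n) (crossed_chain_edges n - F)"
      using assms[OF n] by (auto simp: crossed_chains_deleting_def)
    then interpret crossed_chain n F
      using n by unfold_locales auto
    show ?thesis
      using kirchhoff_wiener_ratio unfolding G_def G .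
  qed
  then have "\<forall>\<^sub>F n in sequentially.
      norm (kirchhoff_index (G n) / wiener_index (G n) - 1 / 4) \<le> norm (9 / 2 / real n) * 1"
    by (intro eventually_sequentiallyI[of "max 1 (r - 1)"]) simp
  then show ?thesis
    by (rule LIM_zero_cancel[OF tendsto_0_le[OF lim_const_over_n]])
qed

end
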